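(* For $\alpha\in\mathbb{R}$ and $x>0$ let $\operatorname{Ki}_{\alpha}(x)=\int_0^{\infty}e^{-x\cosh t}(\cosh t)^{-\alpha}\,dt$. The following assertions are true. (a) For all $\alpha>1/4$ and $x>0$, $$\operatorname{Ki}_{\alpha}(x)\leq\frac{\sqrt{\pi}\,e^{-x}\,\Gamma(\alpha-\frac14)}{2\Gamma(\alpha)\,x^{1/4}}.$$ (b) For all $\alpha\in\mathbb{R}$ and $x>0$, $$\frac{1}{2}\left[\operatorname{Ki}_{\alpha+1}(x)-\operatorname{Ki}_{\alpha-1}(x)\right]<\frac{\partial\operatorname{Ki}_{\alpha}(x)}{\partial\alpha}<\frac{1}{2}\left[\operatorname{Ki}_{\alpha+2}(x)-\operatorname{Ki}_{\alpha}(x)\right].$$ (c) For all $\alpha\in\mathbb{R}$ and $x>0$, $$\left[\operatorname{Ki}_{\alpha}(x)\right]^4\leq\frac{\pi^2}{2}\operatorname{Ki}_{2\alpha}(2x)\operatorname{Ki}_{2\alpha-2}(2x).$$ (d) If $\alpha>0$ and $x>0$, then $$\operatorname{Ki}_{\alpha}(x)\leq\frac{\sqrt{\pi}\,\alpha^{\alpha}\,\Gamma(\alpha)}{2(ex)^{\alpha}\,\Gamma\left(\alpha+\frac{1}{2}\right)}.$$ (e) Let $p,q$ be real numbers with $1/p+1/q=1$ and $\min\{p,q\}>1$. Then for all $\alpha>0$ and $x>0$, $$\left[\operatorname{Ki}_\alpha(0)-x\operatorname{Ki}_{\alpha-1}(0)\right]_+\leq\operatorname{Ki}_\alpha(x)\leq\left[K_0(xp)\right]^{1/p}\left[\operatorname{Ki}_{\alpha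 q}(0)\right]^{1/q}\leq\frac{\sqrt{\pi}}{2^{1/q+1/(2p)}\,p^{1/(2p)}}\left[\frac{\Gamma\left(\frac{\alpha q}{2}\right)}{\Gamma\left(\frac{\alpha q+1}{2}\right)}\right]^{1/q}\cdot\frac{e^{-x}}{x^{1/(2p)}}.$$ Here $[A]_+=\max\{A,0\}$.
   Context: $\operatorname{Ki}_{\alpha}$ is the Bickley function, defined for every real $\alpha$ and $x>0$ by the integral in the claim. $\Gamma$ is the Euler gamma function and $K_0$ is the modified Bessel function of the second kind of order zero, $K_0(x)=\operatorname{Ki}_0(x)=\int_0^\infty e^{-x\cosh t}\,dt$ for $x>0$. At $x=0$, $\operatorname{Ki}_\alpha(0)=\int_0^\infty(\cosh t)^{-\alpha}\,dt$, which for $\alpha>0$ equals $\dfrac{\sqrt{\pi}\,\Gamma(\alpha/2)}{2\Gamma((\alpha+1)/2)}$. For $\alpha\leq0$ this integral is $+\infty$; accordingly, in (e) when $0<\alpha\leq1$ the quantity $\operatorname{Ki}_\alpha(0)-x\operatorname{Ki}_{\alpha-1}(0)$ is read as $-\infty$, so that its positive part is $0$. *)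

theory Defs
  imports "HOL-Analysis.Analysis"
begin

definition bickley_integrand :: "real \<Rightarrow> real \<Rightarrow> real \<Rightarrow> real" where
  "bickley_integrand \<alpha> x t = exp (- x * cosh t) * cosh t powr (- \<alpha>)"

definition Ki :: "real \<Rightarrow> real \<Rightarrow> real" where
  "Ki \<alpha> x = (LINT t:{0..}|lborel. bickley_integrand \<alpha> x t)"

(* The Bochner integral in Ki is 0 by convention where the integral diverges,
   in particular for x = 0 with \<alpha> \<le> 0.  The extended-valued version takes
   the value \<infinity> there. *)
definition Ki_ext :: "real \<Rightarrow> real \<Rightarrow> ereal" where
  "Ki_ext \<alpha> x = enn2ereal (\<integral>\<^sup>+ t\<in>{0..}. ennreal (bickley_integrand \<alpha> x t) \<partial>lborel)"

definition bessel_K0 :: "real \<Rightarrow> real" where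
  "bessel_K0 x = (LINT t:{0..}|lborel. exp (- x * cosh t))"

lemma bessel_K0_eq_Ki: "bessel_K0 x = Ki 0 x"
  unfolding bessel_K0_def Ki_def bickley_integrand_def by simp

lemma bickley_integrand_nonneg: "0 \<le> bickley_integrand \<alpha> x t"
  by (simp add: bickley_integrand_def)

lemma Ki_ext_eq_Ki:
  assumes "set_integrable lborel {0..} (bickley_integrand \<alpha> x)"
  shows "Ki_ext \<alpha> x = ereal (Ki \<alpha> x)"
proof -
  have "(\<integral>\<^sup>+ t\<in>{0..}. ennreal (bickley_integrand \<alpha> x t) \<partial>lborel)
      = (\<integral>\<^sup>+ t. ennreal (indicator {0..} t *\<^sub>R bickley_integrand \<alpha> x t) \<partial>lborel)"
    by (intro nn_integral_cong) (auto simp: indicator_def)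
  also have "\<dots> = ennreal (Ki \<alpha> x)"
    unfolding Ki_def set_lebesgue_integral_def
    by (intro nn_integral_eq_integral)
       (use assms in \<open>auto simp: set_integrable_def bickley_integrand_nonneg\<close>)
  finally have *: "Ki_ext \<alpha> x = enn2ereal (ennreal (Ki \<alpha> x))"
    by (simp add: Ki_ext_def)
  have "0 \<le> Ki \<alpha> x"
    unfolding Ki_def set_lebesgue_integral_def
    by (intro integral_nonneg_AE) (auto simp: bickley_integrand_nonneg)
  with * show ?thesis by (simp add: enn2ereal_ennreal)
qed

lemma bickley_integrable_if_exp_bound:
  assumes "a > 0" and "C > 0"
    and "\<And>t. t \<ge> 0 \<Longrightarrow> bickley_integrand \<alpha> x t \<le> C * exp (- a * t)"
  shows "set_integrable lborel {0..} (bickley_integrand \<alpha> x)"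
proof -
  have "set_integrable lebesgue {0..} (\<lambda>t. exp (- a * t))"
    using assms(1)
    by (intro nonnegative_absolutely_integrable_1 integrable_on_exp_minus_to_infinity) auto
  hence "set_integrable lborel {0..} (\<lambda>t. exp (- a * t))"
    unfolding set_integrable_def by (subst (asm) integrable_completion) auto
  hence 1: "set_integrable lborel {0..} (\<lambda>t. C * exp (- a * t))"
    by (rule set_integrable_mult_right)
  have "continuous_on UNIV (bickley_integrand \<alpha> x)"
    unfolding bickley_integrand_def by (intro continuous_intros) simp
  hence "bickley_integrand \<alpha> x \<in> borel_measurable lborel"
    by (simp add: borel_measurable_continuous_onI)
  hence "set_borel_measurable lborel {0..} (bickley_integrand \<alpha> x)"
    unfolding set_borel_measurable_def by measurable
  thus ?thesis
    by (rule set_integrable_bound[OF 1])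
       (use assms in \<open>auto simp: bickley_integrand_nonneg\<close>)
qed

lemma bickley_integrable_pos:
  assumes "x > 0"
  shows "set_integrable lborel {0..} (bickley_integrand \<alpha> x)"
proof -
  define m where "m = Suc (nat \<lceil>\<bar>\<alpha>\<bar>\<rceil>)"
  define C where "C = (2 * real m / x) ^ m"
  have m: "m > 0" "- \<alpha> \<le> real m" unfolding m_def by simp linarith
  have "C > 0" using assms m by (simp add: C_def)
  have "bickley_integrand \<alpha> x t \<le> C * exp (- (x / 4) * t)" if "t \<ge> 0" for t
  proof -
    let ?c = "cosh t"
    have c1: "1 \<le> ?c" by (rule cosh_real_ge_1)
    have "t \<le> exp t + exp (- t)"
      using exp_ge_add_one_self[of t] exp_gt_zero[of "- t"] by linarith
    hence ct: "t / 2 \<le> ?c" by (simp add: cosh_field_def)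
    have "x / 2 * ?c / real m \<le> exp (x / 2 * ?c / real m)"
      using exp_ge_add_one_self[of "x / 2 * ?c / real m"] by linarith
    hence "(x / 2 * ?c / real m) ^ m \<le> exp (x / 2 * ?c / real m) ^ m"
      using assms c1 by (intro power_mono) auto
    also have "\<dots> = exp (x / 2 * ?c)" using m by (intro exp_divide_power_eq)
    finally have "C * (x / 2 * ?c / real m) ^ m \<le> C * exp (x / 2 * ?c)"
      using \<open>C > 0\<close> by (intro mult_left_mono) auto
    moreover have "C * (x / 2 * ?c / real m) ^ m = ?c ^ m"
      using assms m by (simp add: C_def flip: power_mult_distrib)
    moreover have "?c powr (- \<alpha>) \<le> ?c powr real m" using c1 m by (intro powr_mono) auto
    moreover have "?c powr real m = ?c ^ m" using c1 by (simp add: powr_realpow)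
    ultimately have "?c powr (- \<alpha>) \<le> C * exp (x / 2 * ?c)" by linarith
    hence "bickley_integrand \<alpha> x t \<le> exp (- x * ?c) * (C * exp (x / 2 * ?c))"
      unfolding bickley_integrand_def by (intro mult_left_mono) auto
    also have "\<dots> = C * exp (- (x / 2) * ?c)"
      by (simp add: mult_exp_exp)
    also have "\<dots> \<le> C * exp (- (x / 4) * t)"
      using mult_left_mono[OF ct, of "x / 2"] assms \<open>C > 0\<close> by (intro mult_left_mono) auto
    finally show ?thesis .
  qed
  with assms \<open>C > 0\<close> show ?thesis
    by (intro bickley_integrable_if_exp_bound[of "x / 4" C]) auto
qed

lemma bickley_integrable_zero:
  assumes "\<alpha> > 0"
  shows "set_integrable lborel {0..} (bickley_integrand \<alpha> 0)"
proof (rule bickley_integrable_if_exp_bound[of \<alpha> "2 powr \<alpha>"])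
  fix t :: real
  have "cosh t powr (- \<alpha>) \<le> (exp t / 2) powr (- \<alpha>)"
    using assms by (intro powr_mono2') (auto simp: cosh_field_def)
  also have "\<dots> = 2 powr \<alpha> * exp (- \<alpha> * t)"
    by (simp add: powr_def ln_div algebra_simps flip: exp_add)
  finally show "bickley_integrand \<alpha> 0 t \<le> 2 powr \<alpha> * exp (- \<alpha> * t)"
    by (simp add: bickley_integrand_def)
qed (use assms in auto)

lemma Ki_ext_zero_nonpos:
  assumes "\<alpha> \<le> 0"
  shows "Ki_ext \<alpha> 0 = \<infinity>"
proof -
  have "(\<infinity>::ennreal) = emeasure lborel {0::real..}"
  proof (cases "emeasure lborel {0::real..}")
    case (real r)
    have "ennreal (r + 1) = emeasure lborel {0..r + 1}" using real by simp
    also have "\<dots> \<le> emeasure lborel {0::real..}" by (intro emeasure_mono) auto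
    finally show ?thesis using real by simp
  qed simp
  also have "\<dots> = (\<integral>\<^sup>+ t. indicator {0::real..} t \<partial>lborel)"
    by simp
  also have "\<dots> \<le> (\<integral>\<^sup>+ t\<in>{0..}. ennreal (bickley_integrand \<alpha> 0 t) \<partial>lborel)"
    using assms
    by (intro nn_integral_mono)
       (auto simp: indicator_def bickley_integrand_def cosh_real_ge_1 ge_one_powr_ge_zero)
  finally have "(\<integral>\<^sup>+ t\<in>{0..}. ennreal (bickley_integrand \<alpha> 0 t) \<partial>lborel) = \<infinity>"
    by (simp add: top_unique)
  thus ?thesis by (simp add: Ki_ext_def)
qed

end

theory Submission
  imports Defs "HOL-Probability.Distributions"
begin

text \<open>
  From \<open>cosh t \<ge> 1 + t\<^sup>2 / 2\<close> one gets \<open>K\<^sub>0(x) \<le> e\<^sup>-\<^sup>x sqrt (\<pi> / (2 x))\<close>; inserting this into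
  \<open>\<Gamma>(\<alpha>) Ki\<^sub>\<alpha>(x) = \<integral> s\<^sup>\<alpha>\<^sup>-\<^sup>1 K\<^sub>0(x + s) ds\<close> and using \<open>x + s \<ge> 2 sqrt (x s)\<close> gives (a).
  For (b), differentiate under the integral and use \<open>(1 - c\<^sup>-\<^sup>2) / 2 < ln c < (c - 1 / c) / 2\<close> for
  \<open>c = cosh t > 1\<close>. Part (c) is Carlson's inequality together with \<open>2 t\<^sup>2 \<le> cosh\<^sup>2 t\<close>.
  Part (d) follows from \<open>y\<^sup>\<alpha> e\<^sup>-\<^sup>y \<le> (\<alpha> / e)\<^sup>\<alpha>\<close> with \<open>y = x cosh t\<close> and the Beta integral for
  \<open>Ki\<^sub>2\<^sub>\<alpha>(0)\<close>. Part (e) combines \<open>e\<^sup>-\<^sup>y \<ge> 1 - y\<close>, Hoelder's inequality and the bound on \<open>K\<^sub>0\<close>.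
\<close>

section \<open>Quadratic lower bounds for the hyperbolic cosine\<close>

text \<open>Half-angle form: \<open>cosh t - 1\<close> equals \<open>2 * (sinh (t / 2))^2\<close>,
  and \<open>sinh\<close> dominates its argument in absolute value.\<close>

lemma cosh_ge_quadratic: "1 + t\<^sup>2 / 2 \<le> cosh (t::real)"
proof -
  have "cosh t = 1 + 2 * (sinh (t / 2))\<^sup>2"
    using cosh_double[of "t / 2"] by (simp add: cosh_square_eq)
  moreover have "\<bar>t / 2\<bar> \<le> \<bar>sinh (t / 2)\<bar>"
    using real_le_abs_sinh[of "t / 2"] by (simp add: sinh_field_def exp_minus)
  hence "(t / 2)\<^sup>2 \<le> (sinh (t / 2))\<^sup>2"
    by (simp only: abs_le_square_iff)
  ultimately show ?thesis
    by (simp add: power_divide)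
qed

text \<open>With \<open>u = t^2 / 2\<close>, the quadratic bound squared gives
  \<open>(1 + u)^2 >= 4 * u\<close>. This lets \<open>cosh t\<close> replace the factor
  \<open>t\<close> in Carlson's inequality.\<close>

lemma cosh_square_ge: "2 * t\<^sup>2 \<le> (cosh (t::real))\<^sup>2"
proof -
  have "2 * t\<^sup>2 \<le> (1 + t\<^sup>2 / 2)\<^sup>2"
    using zero_le_power2[of "1 - t\<^sup>2 / 2"] by (simp add: power2_eq_square algebra_simps)
  also have "\<dots> \<le> (cosh t)\<^sup>2"
    by (intro power_mono cosh_ge_quadratic) simp
  finally show ?thesis .
qed

section \<open>Strict comparison of integrals and positivity of \<open>Ki\<close>\<close>

text \<open>If the integral of the nonnegative function \<open>g - f\<close> vanished, then
  \<open>g = f\<close> almost everywhere on \<open>A\<close>, which is impossible on the non-null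
  set \<open>B\<close>.\<close>

lemma set_integral_strict_mono:
  fixes f g :: "'a \<Rightarrow> real"
  assumes f: "set_integrable M A f" and g: "set_integrable M A g"
    and B: "B \<in> sets M" "emeasure M B \<noteq> 0" "B \<subseteq> A"
    and le: "\<And>t. t \<in> A \<Longrightarrow> f t \<le> g t" and less: "\<And>t. t \<in> B \<Longrightarrow> f t < g t"
  shows "(LINT t:A|M. f t) < (LINT t:A|M. g t)"
proof -
  have int: "set_integrable M A (\<lambda>t. g t - f t)"
    using g f by (rule set_integral_diff(1))
  have "(LINT t:A|M. g t - f t) \<noteq> 0"
  proof
    assume "(LINT t:A|M. g t - f t) = 0"
    hence "AE t in M. indicator A t *\<^sub>R (g t - f t) = 0"
      using int le unfolding set_lebesgue_integral_def set_integrable_def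
      by (subst (asm) integral_nonneg_eq_0_iff_AE) (auto simp: indicator_def)
    hence "AE t in M. t \<notin> B"
      by (rule eventually_mono) (use B less in \<open>force simp: indicator_def\<close>)
    hence "emeasure M B = 0"
      using B(1) by (subst (asm) AE_iff_measurable[of B]) (auto dest: sets.sets_into_space)
    with B show False by simp
  qed
  moreover have "(LINT t:A|M. g t - f t) \<ge> 0"
    using le unfolding set_lebesgue_integral_def
    by (intro integral_nonneg_AE) (auto simp: indicator_def)
  ultimately show ?thesis
    using set_integral_diff(2)[OF g f] by simp
qed

text \<open>Equality is permitted at \<open>t = 0\<close>, where \<open>cosh t = 1\<close> turns the
  logarithm bounds used later into equalities.\<close>

lemma half_line_integral_strict_mono:
  fixes f g :: "real \<Rightarrow> real"
  assumes "set_integrable lborel {0..} f" "set_integrable lborel {0..} g"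
    and "\<And>t. t \<ge> 0 \<Longrightarrow> f t \<le> g t" and "\<And>t. t > 0 \<Longrightarrow> f t < g t"
  shows "(LINT t:{0..}|lborel. f t) < (LINT t:{0..}|lborel. g t)"
proof (rule set_integral_strict_mono[where B = "{0<..<1}"])
qed (use assms in auto)

lemma Ki_pos:
  assumes "set_integrable lborel {0..} (bickley_integrand \<alpha> x)"
  shows "Ki \<alpha> x > 0"
proof -
  have "(LINT t:{0::real..}|lborel. 0) < (LINT t:{0..}|lborel. bickley_integrand \<alpha> x t)"
    by (rule half_line_integral_strict_mono[OF _ assms])
       (auto simp: bickley_integrand_def set_integrable_def)
  thus ?thesis by (simp add: Ki_def)
qed

section \<open>The Gaussian bound on K_0\<close>

lemma gaussian_half_line:
  assumes "a > 0"
  shows "has_bochner_integral lborel (\<lambda>t. indicator {0..} t *\<^sub>R exp (- (a * t\<^sup>2))) (sqrt (pi / a) / 2)"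
proof -
  have "has_bochner_integral lborel
      (\<lambda>t. indicator {0..} (0 + sqrt a * t) *\<^sub>R exp (- (0 + sqrt a * t)\<^sup>2)) ((sqrt pi / 2) /\<^sub>R \<bar>sqrt a\<bar>)"
    using assms gaussian_moment_0
    by (subst (asm) lborel_has_bochner_integral_real_affine_iff[where c = "sqrt a" and t = 0]) auto
  also have "(\<lambda>t. indicator {0..} (0 + sqrt a * t) *\<^sub>R exp (- (0 + sqrt a * t)\<^sup>2))
      = (\<lambda>t. indicator {0..} t *\<^sub>R exp (- (a * t\<^sup>2)))"
    using assms by (auto simp: fun_eq_iff indicator_def power_mult_distrib zero_le_mult_iff)
  also have "(sqrt pi / 2) /\<^sub>R \<bar>sqrt a\<bar> = sqrt (pi / a) / 2"
    using assms by (simp add: real_sqrt_divide field_simps)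
  finally show ?thesis .
qed

text \<open>The quadratic bound on \<open>cosh\<close> puts the integrand below
  \<open>exp (- x)\<close> times a Gaussian with parameter \<open>x / 2\<close>.\<close>

lemma bessel_K0_le:
  assumes "x > 0"
  shows "bessel_K0 x \<le> exp (- x) * sqrt (pi / (2 * x))"
proof -
  have G: "has_bochner_integral lborel
      (\<lambda>t. exp (- x) * (indicator {0..} t *\<^sub>R exp (- (x / 2 * t\<^sup>2)))) (exp (- x) * (sqrt (pi / (x / 2)) / 2))"
    using assms by (intro has_bochner_integral_mult_right gaussian_half_line) auto
  have "bessel_K0 x \<le> exp (- x) * (sqrt (pi / (x / 2)) / 2)"
    unfolding bessel_K0_def set_lebesgue_integral_def
  proof (subst has_bochner_integral_integral_eq[OF G, symmetric], rule integral_mono)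
    show "integrable lborel (\<lambda>t. indicator {0..} t *\<^sub>R exp (- x * cosh t))"
      using bickley_integrable_pos[OF assms, of 0]
      by (simp add: set_integrable_def bickley_integrand_def)
    show "integrable lborel (\<lambda>t. exp (- x) * (indicator {0..} t *\<^sub>R exp (- (x / 2 * t\<^sup>2))))"
      using G by (simp add: has_bochner_integral_iff)
    show "indicator {0..} t *\<^sub>R exp (- x * cosh t) \<le> exp (- x) * (indicator {0..} t *\<^sub>R exp (- (x / 2 * t\<^sup>2)))" for t :: real
      using mult_left_mono[OF cosh_ge_quadratic[of t], of x] assms
      by (auto simp: indicator_def mult_exp_exp algebra_simps)
  qed
  also have "sqrt (pi / (x / 2)) / 2 = sqrt (pi / (2 * x))"
    by (rule real_sqrt_unique[symmetric]) (use assms in \<open>auto simp: power_divide field_simps\<close>)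
  finally show ?thesis .
qed

section \<open>Evaluation of \<open>Ki\<close> at zero by a Beta integral\<close>

text \<open>The substitution \<open>u = tanh\<^sup>2 t\<close> turns \<open>Ki\<^sub>a(0)\<close> into a Beta integral.\<close>

lemma image_tanh_square: "(\<lambda>t::real. (tanh t)\<^sup>2) ` {0<..} = {0<..<1}"
proof safe
  fix t :: real assume "t > 0"
  thus "(tanh t)\<^sup>2 \<in> {0<..<1}"
    using tanh_real_bounds[of t] by (simp add: abs_square_less_1 abs_if)
next
  fix u :: real assume u: "u \<in> {0<..<1}"
  have s: "0 < sqrt u" "sqrt u < 1" using u by auto
  \<comment> \<open>The preimage of \<open>u\<close> is \<open>artanh (sqrt u)\<close>; this is
    verified from the expression of \<open>tanh\<close> through
    \<open>exp (- 2 * t)\<close>.\<close>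
  have "tanh (artanh (sqrt u)) = sqrt u"
  proof -
    have "exp (ln ((1 + sqrt u) / (1 - sqrt u))) = (1 + sqrt u) / (1 - sqrt u)"
      using s by (intro exp_ln divide_pos_pos) linarith+
    hence "exp (- 2 * artanh (sqrt u)) = (1 - sqrt u) / (1 + sqrt u)"
      by (simp add: artanh_def exp_minus)
    hence "tanh (artanh (sqrt u)) = (1 - (1 - sqrt u) / (1 + sqrt u)) / (1 + (1 - sqrt u) / (1 + sqrt u))"
      by (simp only: tanh_real_altdef)
    also have "\<dots> = sqrt u"
    proof -
      have "1 + sqrt u \<noteq> 0" using s by linarith
      thus ?thesis by (simp add: field_simps)
    qed
    finally show ?thesis .
  qed
  moreover from this have "artanh (sqrt u) > 0" using s by (metis tanh_real_pos_iff)
  ultimately show "u \<in> (\<lambda>t. (tanh t)\<^sup>2) ` {0<..}" using u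
    by (intro image_eqI[of _ _ "artanh (sqrt u)"]) auto
qed

text \<open>For \<open>u = (tanh t)^2\<close> the Jacobian is \<open>2 * tanh t * (1 - u)\<close>
  and \<open>1 - u = cosh t powr (-2)\<close>. The Beta integrand therefore pulls back to
  \<open>2 * cosh t powr (- a)\<close>, so that twice \<open>Ki a 0\<close> is
  \<open>Beta (1 / 2) (a / 2)\<close>.\<close>

lemma Ki_zero:
  assumes "a > 0"
  shows "Ki a 0 = sqrt pi * Gamma (a / 2) / (2 * Gamma ((a + 1) / 2))"
proof -
  let ?f = "\<lambda>u::real. u powr (1 / 2 - 1) * (1 - u) powr (a / 2 - 1)"
  let ?g' = "\<lambda>t::real. 2 * tanh t * (1 - (tanh t)\<^sup>2)"
  have hi: "(?f has_integral Beta (1 / 2) (a / 2)) {0<..<1}"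
    using has_integral_Beta_real[of "1 / 2" "a / 2"] assms by (simp add: has_integral_Icc_iff_Ioo)
  hence "?f absolutely_integrable_on {0<..<1}"
    by (intro nonnegative_absolutely_integrable_1) (auto simp: has_integral_iff)
  hence *: "?f absolutely_integrable_on (\<lambda>t::real. (tanh t)\<^sup>2) ` {0<..}
      \<and> integral ((\<lambda>t. (tanh t)\<^sup>2) ` {0<..}) ?f = Beta (1 / 2) (a / 2)"
    using hi by (simp add: image_tanh_square has_integral_iff)
  have "(\<lambda>t. \<bar>?g' t\<bar> * ?f ((tanh t)\<^sup>2)) absolutely_integrable_on {0<..}
      \<and> integral {0<..} (\<lambda>t. \<bar>?g' t\<bar> * ?f ((tanh t)\<^sup>2)) = Beta (1 / 2) (a / 2)"
    by (subst has_absolute_integral_change_of_variables_1'[OF _ _ _, of _ "\<lambda>t. (tanh t)\<^sup>2" ?g'])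
       (use * in \<open>auto intro!: derivative_eq_intros inj_onI simp: power2_eq_iff_nonneg\<close>)
  hence "integral {0<..} (\<lambda>t. \<bar>?g' t\<bar> * ?f ((tanh t)\<^sup>2)) = Beta (1 / 2) (a / 2)" by simp
  also have "integral {0<..} (\<lambda>t. \<bar>?g' t\<bar> * ?f ((tanh t)\<^sup>2)) = integral {0<..} (\<lambda>t. 2 * bickley_integrand a 0 t)"
  proof (rule integral_cong)
    fix t :: real assume "t \<in> {0<..}"
    hence t: "t > 0" "tanh t > 0" by auto
    have sech: "1 - (tanh t)\<^sup>2 = cosh t powr (-2)"
      by (simp add: tanh_def power_divide sinh_square_eq powr_minus field_simps)
    have "((tanh t)\<^sup>2) powr (1 / 2 - 1) = tanh t powr (- 1)"
      using t by (simp add: powr_powr flip: powr_numeral)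
    moreover have "\<bar>?g' t\<bar> = 2 * tanh t * cosh t powr (-2)"
      using t by (simp add: sech)
    moreover have "(1 - (tanh t)\<^sup>2) powr (a / 2 - 1) = cosh t powr (-2 * (a / 2 - 1))"
      by (simp only: sech powr_powr)
    ultimately have "\<bar>?g' t\<bar> * ?f ((tanh t)\<^sup>2)
        = 2 * (tanh t * tanh t powr (- 1)) * (cosh t powr (-2) * cosh t powr (-2 * (a / 2 - 1)))"
      by (simp only: mult_ac)
    moreover have "tanh t * tanh t powr (- 1) = 1"
      using t by (simp add: powr_minus)
    moreover have "cosh t powr (-2) * cosh t powr (-2 * (a / 2 - 1)) = cosh t powr (- a)"
      by (subst powr_add[symmetric]) simp
    ultimately show "\<bar>?g' t\<bar> * ?f ((tanh t)\<^sup>2) = 2 * bickley_integrand a 0 t"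
      by (simp only: bickley_integrand_def) simp
  qed
  also have "\<dots> = 2 * integral {0<..} (bickley_integrand a 0)"
    by simp
  also have "integral {0<..} (bickley_integrand a 0) = integral {0..} (bickley_integrand a 0)"
    by (rule integral_spike_set; rule negligible_subset[of "{0}"]) auto
  also have "\<dots> = Ki a 0"
    unfolding Ki_def using set_borel_integral_eq_integral[OF bickley_integrable_zero[OF assms]] by simp
  finally show ?thesis
    by (simp add: Beta_def Gamma_one_half_real add_divide_distrib add.commute)
qed

section \<open>\<open>Ki\<close> as a fractional integral of K_0, and bound (a)\<close>

text \<open>Passing to nonnegative integrals makes Tonelli's theorem and the Cauchy-Schwarz
  inequality available without integrability conditions.\<close>

lemma Ki_conv_nn_integral:
  assumes "set_integrable lborel {0..} (bickley_integrand \<alpha> x)"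
  shows "ennreal (Ki \<alpha> x) = (\<integral>\<^sup>+ t. ennreal (indicator {0..} t * bickley_integrand \<alpha> x t) \<partial>lborel)"
  unfolding Ki_def set_lebesgue_integral_def
  using assms by (subst nn_integral_eq_integral) (auto simp: set_integrable_def bickley_integrand_nonneg)

lemma bickley_integrand_measurable [measurable]:
  "(\<lambda>t. bickley_integrand \<alpha> x t) \<in> borel_measurable borel"
proof -
  have "continuous_on UNIV (bickley_integrand \<alpha> x)"
    unfolding bickley_integrand_def by (intro continuous_intros) simp
  thus ?thesis by (simp add: borel_measurable_continuous_onI)
qed

lemma cosh_measurable [measurable]: "(cosh :: real \<Rightarrow> real) \<in> borel_measurable borel"
  by (intro borel_measurable_continuous_onI continuous_intros)

text \<open>Substitution of \<open>c * s\<close> for the variable in Euler's integral.\<close>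

lemma nn_integral_Gamma_scaled:
  assumes "\<alpha> > (0::real)" "c > 0"
  shows "(\<integral>\<^sup>+ s. ennreal (indicator {0..} s * (s powr (\<alpha> - 1) * exp (- (c * s)))) \<partial>lborel)
    = ennreal (Gamma \<alpha> * c powr (- \<alpha>))"
proof -
  have "ennreal (Gamma \<alpha>) = ennreal \<bar>c\<bar> * (\<integral>\<^sup>+ s. ennreal (indicator {0..} (0 + c * s) * (0 + c * s) powr (\<alpha> - 1) / exp (0 + c * s)) \<partial>lborel)"
    unfolding Gamma_conv_nn_integral_real[OF assms(1)]
    using assms(2) by (intro nn_integral_real_affine) auto
  also have "(\<integral>\<^sup>+ s. ennreal (indicator {0..} (0 + c * s) * (0 + c * s) powr (\<alpha> - 1) / exp (0 + c * s)) \<partial>lborel)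
      = (\<integral>\<^sup>+ s. ennreal (c powr (\<alpha> - 1)) * ennreal (indicator {0..} s * (s powr (\<alpha> - 1) * exp (- (c * s)))) \<partial>lborel)"
    using assms(2)
    by (intro nn_integral_cong)
       (auto simp: indicator_def powr_mult exp_minus field_simps zero_le_mult_iff simp flip: ennreal_mult')
  also have "\<dots> = ennreal (c powr (\<alpha> - 1)) * (\<integral>\<^sup>+ s. ennreal (indicator {0..} s * (s powr (\<alpha> - 1) * exp (- (c * s)))) \<partial>lborel)"
    by (intro nn_integral_cmult) measurable
  \<comment> \<open>The factor \<open>c powr (- \<alpha>)\<close> cancels the Jacobian
    \<open>c\<close> together with \<open>c powr (\<alpha> - 1)\<close>.\<close>
  finally have "ennreal (c powr (- \<alpha>)) * ennreal (Gamma \<alpha>) = ennreal (c powr (- \<alpha>)) * (ennreal \<bar>c\<bar> * (ennreal (c powr (\<alpha> - 1)) * (\<integral>\<^sup>+ s. ennreal (indicator {0..} s * (s powr (\<alpha> - 1) * exp (- (c * s)))) \<partial>lborel)))"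
    by simp
  also have "\<dots> = ennreal (c powr (- \<alpha>) * (c powr 1 * c powr (\<alpha> - 1))) * (\<integral>\<^sup>+ s. ennreal (indicator {0..} s * (s powr (\<alpha> - 1) * exp (- (c * s)))) \<partial>lborel)"
    using assms(2) by (simp add: ennreal_mult' mult.assoc)
  also have "c powr (- \<alpha>) * (c powr 1 * c powr (\<alpha> - 1)) = 1"
    using assms(2) by (simp only: powr_add[symmetric]) simp
  finally show ?thesis
    using assms by (simp add: mult.commute flip: ennreal_mult')
qed

text \<open>Averaging the exponential representation of \<open>cosh t powr - \<alpha>\<close> makes \<open>Ki\<close> a fractional
  integral of \<open>K\<^sub>0\<close>.\<close>

lemma Gamma_mult_Ki:
  assumes "\<alpha> > 0" "x > 0"
  shows "ennreal (Gamma \<alpha> * Ki \<alpha> x)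
    = (\<integral>\<^sup>+ s. ennreal (indicator {0..} s * (s powr (\<alpha> - 1) * bessel_K0 (x + s))) \<partial>lborel)"
proof -
  let ?h = "\<lambda>t s. ennreal (indicator {0..} t * exp (- x * cosh t)) *
    ennreal (indicator {0..} s * (s powr (\<alpha> - 1) * exp (- (cosh t * s))))"
  have "ennreal (Gamma \<alpha> * Ki \<alpha> x)
      = ennreal (Gamma \<alpha>) * (\<integral>\<^sup>+ t. ennreal (indicator {0..} t * bickley_integrand \<alpha> x t) \<partial>lborel)"
    using assms by (simp add: ennreal_mult' Ki_conv_nn_integral bickley_integrable_pos)
  also have "\<dots> = (\<integral>\<^sup>+ t. ennreal (Gamma \<alpha>) * ennreal (indicator {0..} t * bickley_integrand \<alpha> x t) \<partial>lborel)"
    by (rule nn_integral_cmult[symmetric]) measurable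
  also have "\<dots> = (\<integral>\<^sup>+ t. \<integral>\<^sup>+ s. ?h t s \<partial>lborel \<partial>lborel)"
  proof (rule nn_integral_cong)
    fix t :: real
    have "(\<integral>\<^sup>+ s. ?h t s \<partial>lborel) = ennreal (indicator {0..} t * exp (- x * cosh t)) * ennreal (Gamma \<alpha> * cosh t powr (- \<alpha>))"
      by (subst nn_integral_cmult, measurable) (simp add: nn_integral_Gamma_scaled[OF assms(1)])
    thus "ennreal (Gamma \<alpha>) * ennreal (indicator {0..} t * bickley_integrand \<alpha> x t) = (\<integral>\<^sup>+ s. ?h t s \<partial>lborel)"
      using assms by (simp add: bickley_integrand_def mult_ac flip: ennreal_mult')
  qed
  \<comment> \<open>Tonelli's theorem for the nonnegative kernel. For fixed \<open>s\<close> the two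
    exponentials then merge into \<open>exp (- (x + s) * cosh t)\<close>, the integrand of K_0 at
    \<open>x + s\<close>.\<close>
  also have "\<dots> = (\<integral>\<^sup>+ s. \<integral>\<^sup>+ t. ?h t s \<partial>lborel \<partial>lborel)"
    by (rule lborel_pair.Fubini') measurable
  also have "\<dots> = (\<integral>\<^sup>+ s. ennreal (indicator {0..} s * (s powr (\<alpha> - 1) * bessel_K0 (x + s))) \<partial>lborel)"
  proof (rule nn_integral_cong)
    fix s :: real
    show "(\<integral>\<^sup>+ t. ?h t s \<partial>lborel) = ennreal (indicator {0..} s * (s powr (\<alpha> - 1) * bessel_K0 (x + s)))"
    proof (cases "s \<ge> 0")
      case True
      have "(\<integral>\<^sup>+ t. ?h t s \<partial>lborel)
          = (\<integral>\<^sup>+ t. ennreal (s powr (\<alpha> - 1)) * ennreal (indicator {0..} t * bickley_integrand 0 (x + s) t) \<partial>lborel)"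
        using True
        by (intro nn_integral_cong)
           (auto simp: indicator_def bickley_integrand_def mult_exp_exp algebra_simps simp flip: ennreal_mult')
      also have "\<dots> = ennreal (s powr (\<alpha> - 1)) * ennreal (Ki 0 (x + s))"
        using assms True
        by (subst nn_integral_cmult, measurable) (simp add: Ki_conv_nn_integral bickley_integrable_pos)
      finally show ?thesis
        using True by (simp add: bessel_K0_eq_Ki ennreal_mult')
    qed simp
  qed
  finally show ?thesis .
qed

text \<open>The arithmetic-geometric mean inequality separates \<open>x\<close> from
  \<open>s\<close>, which leaves a Gamma integral in \<open>s\<close>. The exponent 1/4 in (a)
  originates here.\<close>

lemma inverse_sqrt_add_le:
  assumes "x > 0" "s > 0"
  shows "sqrt (pi / (2 * (x + s))) \<le> sqrt pi / 2 * x powr (- 1 / 4) * s powr (- 1 / 4)"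
proof -
  have "2 * sqrt (x * s) \<le> x + s"
    using arith_geo_mean_sqrt[of x s] assms by simp
  hence "sqrt (pi / (2 * (x + s))) \<le> sqrt (pi / (2 * (2 * sqrt (x * s))))"
    using assms by (intro real_sqrt_le_mono divide_left_mono) auto
  also have "\<dots> = sqrt pi / 2 * x powr (- 1 / 4) * s powr (- 1 / 4)"
  proof (rule real_sqrt_unique)
    have "(x powr (- 1 / 4))\<^sup>2 = x powr (- 1 / 2)" "(s powr (- 1 / 4))\<^sup>2 = s powr (- 1 / 2)"
      by (simp_all add: power2_eq_square flip: powr_add)
    thus "(sqrt pi / 2 * x powr (- 1 / 4) * s powr (- 1 / 4))\<^sup>2 = pi / (2 * (2 * sqrt (x * s)))"
      using assms by (simp add: power_mult_distrib power_divide powr_minus powr_half_sqrt real_sqrt_mult field_simps)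
  qed simp
  finally show ?thesis .
qed

text \<open>After the bound on K_0, the factor \<open>s powr (- 1 / 4)\<close> lowers the parameter
  of the Gamma integral to \<open>\<alpha> - 1 / 4\<close>, which is positive by assumption.\<close>

lemma Ki_le_Gamma_quotient:
  assumes "\<alpha> > 1 / 4" "x > 0"
  shows "Ki \<alpha> x \<le> sqrt pi * exp (- x) * Gamma (\<alpha> - 1 / 4) / (2 * Gamma \<alpha> * x powr (1 / 4))"
proof -
  let ?C = "exp (- x) * (sqrt pi / 2 * x powr (- 1 / 4))"
  have \<alpha>: "\<alpha> > 0" using assms by simp
  have "ennreal (Gamma \<alpha> * Ki \<alpha> x)
      = (\<integral>\<^sup>+ s. ennreal (indicator {0..} s * (s powr (\<alpha> - 1) * bessel_K0 (x + s))) \<partial>lborel)"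
    by (rule Gamma_mult_Ki) (use assms in auto)
  also have "\<dots> \<le> (\<integral>\<^sup>+ s. ennreal ?C * ennreal (indicator {0..} s * (s powr ((\<alpha> - 1 / 4) - 1) * exp (- (1 * s)))) \<partial>lborel)"
  proof (rule nn_integral_mono)
    fix s :: real
    show "ennreal (indicator {0..} s * (s powr (\<alpha> - 1) * bessel_K0 (x + s)))
        \<le> ennreal ?C * ennreal (indicator {0..} s * (s powr ((\<alpha> - 1 / 4) - 1) * exp (- (1 * s))))"
    \<comment> \<open>At \<open>s = 0\<close> the left side is zero because
      \<open>0 powr _ = 0\<close>; for negative \<open>s\<close> the indicator vanishes.\<close>
    proof (cases "s > 0")
      case True
      have "bessel_K0 (x + s) \<le> exp (- (x + s)) * sqrt (pi / (2 * (x + s)))"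
        using True assms by (intro bessel_K0_le) auto
      also have "\<dots> \<le> exp (- (x + s)) * (sqrt pi / 2 * x powr (- 1 / 4) * s powr (- 1 / 4))"
        using True assms by (intro mult_left_mono inverse_sqrt_add_le) auto
      finally have "s powr (\<alpha> - 1) * bessel_K0 (x + s)
          \<le> s powr (\<alpha> - 1) * (exp (- (x + s)) * (sqrt pi / 2 * x powr (- 1 / 4) * s powr (- 1 / 4)))"
        by (rule mult_left_mono) simp
      also have "\<dots> = ?C * (exp (- s) * (s powr (\<alpha> - 1) * s powr (- 1 / 4)))"
        by (simp add: exp_add exp_diff exp_minus field_simps)
      also have "s powr (\<alpha> - 1) * s powr (- 1 / 4) = s powr ((\<alpha> - 1 / 4) - 1)"
        by (simp flip: powr_add)
      finally show ?thesis
        using True by (simp add: mult_ac flip: ennreal_mult')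
    qed (auto simp: indicator_def)
  qed
  also have "\<dots> = ennreal ?C * ennreal (Gamma (\<alpha> - 1 / 4) * 1 powr (- (\<alpha> - 1 / 4)))"
    using assms by (subst nn_integral_cmult, measurable) (subst nn_integral_Gamma_scaled, auto)
  also have "\<dots> = ennreal (?C * Gamma (\<alpha> - 1 / 4))"
    by (simp only: powr_one_eq_one mult_1_right) (rule ennreal_mult'[symmetric], simp)
  finally have "Gamma \<alpha> * Ki \<alpha> x \<le> ?C * Gamma (\<alpha> - 1 / 4)"
    using assms by (subst (asm) ennreal_le_iff) (auto intro!: mult_nonneg_nonneg)
  thus ?thesis
    using assms Gamma_real_pos[OF \<alpha>] by (simp add: powr_minus field_simps)
qed

section \<open>Differentiation in the order, and bounds (b)\<close>

text \<open>Since \<open>ln c <= c\<close>, the logarithm costs at most one unit of order, and for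
  \<open>x > 0\<close> every real order is integrable.\<close>

lemma Ki_integrand_ln_integrable:
  assumes "x > 0"
  shows "set_integrable lborel {0..} (\<lambda>t. bickley_integrand \<alpha> x t * ln (cosh t))"
proof (rule set_integrable_bound)
  show "set_integrable lborel {0..} (bickley_integrand (\<alpha> - 1) x)"
    using assms by (rule bickley_integrable_pos)
  show "set_borel_measurable lborel {0..} (\<lambda>t. bickley_integrand \<alpha> x t * ln (cosh t))"
    unfolding set_borel_measurable_def by measurable
  show "AE t in lborel. t \<in> {0..} \<longrightarrow>
      norm (bickley_integrand \<alpha> x t * ln (cosh t)) \<le> norm (bickley_integrand (\<alpha> - 1) x t)"
  proof (intro AE_I2 impI)
    fix t :: real
    have c: "cosh t \<ge> 1" by (rule cosh_real_ge_1)
    have "bickley_integrand \<alpha> x t * ln (cosh t) \<le> bickley_integrand \<alpha> x t * cosh t"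
      using c ln_le_minus_one[of "cosh t"] by (intro mult_left_mono bickley_integrand_nonneg) auto
    also have "\<dots> = bickley_integrand (\<alpha> - 1) x t"
      using c by (simp add: bickley_integrand_def powr_mult_base mult_ac)
    finally show "norm (bickley_integrand \<alpha> x t * ln (cosh t)) \<le> norm (bickley_integrand (\<alpha> - 1) x t)"
      using c by (simp add: bickley_integrand_nonneg)
  qed
qed

text \<open>Lagrange form of the second-order remainder; its factor 1/2 is discarded.\<close>

lemma exp_Taylor_remainder_le: "\<bar>exp y - 1 - y\<bar> \<le> y\<^sup>2 * exp \<bar>y\<bar>" for y :: real
proof -
  obtain t where t: "\<bar>t\<bar> \<le> \<bar>y\<bar>" "exp y = (\<Sum>m<2. y ^ m / fact m) + exp t / fact 2 * y ^ 2"
    using Maclaurin_exp_le[of y 2] by blast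
  have "exp y - 1 - y = exp t / 2 * y\<^sup>2"
    using t(2) by (simp add: numeral_2_eq_2)
  moreover have "exp t \<le> exp \<bar>y\<bar>"
    using t(1) by simp
  hence "exp t / 2 * y\<^sup>2 \<le> exp \<bar>y\<bar> * y\<^sup>2"
    using exp_gt_zero[of t] by (intro mult_right_mono) (linarith | simp)+
  moreover have "0 \<le> exp t / 2 * y\<^sup>2" by simp
  ultimately show ?thesis by (metis abs_of_nonneg mult.commute)
qed

text \<open>Expand \<open>c powr (- h) = exp (- h * ln c)\<close> to first order in
  \<open>h\<close>. The remainder is at most \<open>(h * ln c)^2 * exp \<bar>h * ln c\<bar>\<close>,
  hence at most \<open>h^2 * c^2 * c\<close>; these three powers of \<open>c\<close> give the shift
  by 3.\<close>

lemma powr_minus_expansion_le: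
  assumes "c \<ge> (1::real)" "\<bar>h\<bar> \<le> 1"
  shows "\<bar>c powr (- (\<alpha> + h)) - c powr (- \<alpha>) + h * (c powr (- \<alpha>) * ln c)\<bar> \<le> h\<^sup>2 * c powr (- (\<alpha> - 3))"
proof -
  let ?y = "- h * ln c"
  have ln: "ln c \<le> c" "0 \<le> ln c"
    using assms ln_le_minus_one[of c] by auto
  have "c powr (- (\<alpha> + h)) = c powr (- \<alpha>) * c powr (- h)"
    by (simp flip: powr_add)
  also have "c powr (- h) = exp ?y"
    using assms by (simp add: powr_def)
  finally have "c powr (- (\<alpha> + h)) - c powr (- \<alpha>) + h * (c powr (- \<alpha>) * ln c)
      = c powr (- \<alpha>) * (exp ?y - 1 - ?y)"
    by (simp add: algebra_simps)
  hence "\<bar>c powr (- (\<alpha> + h)) - c powr (- \<alpha>) + h * (c powr (- \<alpha>) * ln c)\<bar>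
      = c powr (- \<alpha>) * \<bar>exp ?y - 1 - ?y\<bar>"
    by (simp only: abs_mult) simp
  also have "\<dots> \<le> c powr (- \<alpha>) * (?y\<^sup>2 * exp \<bar>?y\<bar>)"
    by (intro mult_left_mono exp_Taylor_remainder_le) simp
  also have "\<dots> \<le> c powr (- \<alpha>) * ((h\<^sup>2 * c\<^sup>2) * c)"
  proof (intro mult_left_mono mult_mono)
    show "?y\<^sup>2 \<le> h\<^sup>2 * c\<^sup>2"
      using ln by (simp add: power_mult_distrib mult_left_mono power_mono)
    have "\<bar>?y\<bar> \<le> ln c"
      using assms ln by (simp add: abs_mult mult_left_le_one_le)
    hence "exp \<bar>?y\<bar> \<le> exp (ln c)" by simp
    thus "exp \<bar>?y\<bar> \<le> c" using assms by simp
  qed auto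
  also have "\<dots> = h\<^sup>2 * (c powr (- \<alpha>) * c powr 3)"
    using assms by (simp add: power2_eq_square power3_eq_cube)
  also have "c powr (- \<alpha>) * c powr 3 = c powr (- (\<alpha> - 3))"
    by (simp flip: powr_add)
  finally show ?thesis .
qed

text \<open>The pointwise expansion is integrated with its explicit quadratic error, so the
  difference quotient converges by a direct estimate.\<close>

lemma Ki_has_real_derivative:
  assumes "x > 0"
  shows "((\<lambda>a. Ki a x) has_real_derivative
    - (LINT t:{0..}|lborel. bickley_integrand \<alpha> x t * ln (cosh t))) (at \<alpha>)"
proof -
  define L where "L = (LINT t:{0..}|lborel. bickley_integrand \<alpha> x t * ln (cosh t))"
  \<comment> \<open>The coefficient of \<open>h^2\<close> after integrating the pointwise
    remainder.\<close>
  define M where "M = Ki (\<alpha> - 3) x"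
  note int = bickley_integrable_pos[OF assms] Ki_integrand_ln_integrable[OF assms]
  have remainder: "\<bar>Ki (\<alpha> + h) x - Ki \<alpha> x + h * L\<bar> \<le> h\<^sup>2 * M" if h: "\<bar>h\<bar> \<le> 1" for h
  proof -
    let ?r = "\<lambda>t. bickley_integrand (\<alpha> + h) x t - bickley_integrand \<alpha> x t + h * (bickley_integrand \<alpha> x t * ln (cosh t))"
    have r: "set_integrable lborel {0..} ?r"
      by (intro set_integral_add set_integral_diff set_integrable_mult_right int)
    have "\<bar>Ki (\<alpha> + h) x - Ki \<alpha> x + h * L\<bar> = \<bar>LINT t:{0..}|lborel. ?r t\<bar>"
      unfolding Ki_def L_def
      by (simp add: set_integral_add set_integral_diff int)
    also have "\<dots> \<le> (LINT t:{0..}|lborel. \<bar>?r t\<bar>)"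
      using set_integral_norm_bound[OF r] by simp
    also have "\<dots> \<le> (LINT t:{0..}|lborel. h\<^sup>2 * bickley_integrand (\<alpha> - 3) x t)"
    proof (rule set_integral_mono)
      show "set_integrable lborel {0..} (\<lambda>t. \<bar>?r t\<bar>)"
        using r by (rule set_integrable_abs)
      show "set_integrable lborel {0..} (\<lambda>t. h\<^sup>2 * bickley_integrand (\<alpha> - 3) x t)"
        by (intro set_integrable_mult_right int)
      fix t :: real
      let ?c = "cosh t"
      have "?r t = exp (- x * ?c) * (?c powr (- (\<alpha> + h)) - ?c powr (- \<alpha>) + h * (?c powr (- \<alpha>) * ln ?c))"
        by (simp add: bickley_integrand_def algebra_simps)
      hence "\<bar>?r t\<bar> = exp (- x * ?c) * \<bar>?c powr (- (\<alpha> + h)) - ?c powr (- \<alpha>) + h * (?c powr (- \<alpha>) * ln ?c)\<bar>"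
        by (simp only: abs_mult) simp
      also have "\<dots> \<le> exp (- x * ?c) * (h\<^sup>2 * ?c powr (- (\<alpha> - 3)))"
        using h by (intro mult_left_mono powr_minus_expansion_le cosh_real_ge_1) auto
      finally show "\<bar>?r t\<bar> \<le> h\<^sup>2 * bickley_integrand (\<alpha> - 3) x t"
        by (simp add: bickley_integrand_def mult_ac)
    qed
    also have "\<dots> = h\<^sup>2 * M"
      by (simp add: M_def Ki_def)
    finally show ?thesis .
  qed
  have "((\<lambda>h. (Ki (\<alpha> + h) x - Ki \<alpha> x) / h - (- L)) \<longlongrightarrow> 0) (at 0)"
  proof (rule Lim_null_comparison)
    show "\<forall>\<^sub>F h in at 0. norm ((Ki (\<alpha> + h) x - Ki \<alpha> x) / h - (- L)) \<le> \<bar>h\<bar> * M"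
      unfolding eventually_at
    proof (intro exI[of _ 1] conjI ballI impI)
      fix h :: real assume "h \<noteq> 0 \<and> dist h 0 < 1"
      hence h: "h \<noteq> 0" "\<bar>h\<bar> \<le> 1" by auto
      have "(Ki (\<alpha> + h) x - Ki \<alpha> x) / h - (- L) = (Ki (\<alpha> + h) x - Ki \<alpha> x + h * L) / h"
        using h by (simp add: field_simps)
      hence "norm ((Ki (\<alpha> + h) x - Ki \<alpha> x) / h - (- L)) = \<bar>Ki (\<alpha> + h) x - Ki \<alpha> x + h * L\<bar> / \<bar>h\<bar>"
        by (simp only: real_norm_def abs_divide)
      also have "\<dots> \<le> h\<^sup>2 * M / \<bar>h\<bar>"
        by (intro divide_right_mono remainder h) simp
      also have "\<dots> = \<bar>h\<bar> * M"
        using h by (simp add: power2_eq_square field_simps flip: power2_abs)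
      finally show "norm ((Ki (\<alpha> + h) x - Ki \<alpha> x) / h - (- L)) \<le> \<bar>h\<bar> * M" .
    qed auto
    show "((\<lambda>h. \<bar>h\<bar> * M) \<longlongrightarrow> 0) (at 0)"
      by (rule tendsto_eq_intros refl | simp)+
  qed
  thus ?thesis
    unfolding DERIV_def L_def[symmetric] by (simp only: LIM_zero_iff)
qed

text \<open>The difference of the two sides vanishes at 1 and has derivative
  \<open>(1 - 1 / y)^2 / 2\<close>, positive for \<open>y > 1\<close>.\<close>

lemma ln_less_half_diff_inverse:
  assumes "c > (1::real)"
  shows "ln c < (c - 1 / c) / 2"
proof -
  have "(1 - 1 / 1) / 2 - ln 1 < (c - 1 / c) / 2 - ln c"
  proof (rule DERIV_pos_imp_increasing_open[of 1 c "\<lambda>c. (c - 1 / c) / 2 - ln c"])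
    fix y :: real assume y: "1 < y" "y < c"
    have "((\<lambda>c. (c - 1 / c) / 2 - ln c) has_real_derivative ((1 + 1 / y\<^sup>2) / 2 - 1 / y)) (at y)"
      using y by (auto intro!: derivative_eq_intros simp: power2_eq_square field_simps)
    moreover have "(1 + 1 / y\<^sup>2) / 2 - 1 / y = (1 - 1 / y)\<^sup>2 / 2"
      using y by (simp add: power2_eq_square field_simps)
    ultimately show "\<exists>D. ((\<lambda>c. (c - 1 / c) / 2 - ln c) has_real_derivative D) (at y) \<and> D > 0"
      using y by (intro exI[of _ "(1 - 1 / y)\<^sup>2 / 2"]) auto
  next
    show "continuous_on {1..c} (\<lambda>c. (c - 1 / c) / 2 - ln c)"
      by (intro continuous_intros) auto
  qed (use assms in auto)
  thus ?thesis by simp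
qed

text \<open>This is the strict inequality \<open>ln u < u - 1\<close> at \<open>u = 1 / c^2\<close>,
  which differs from 1.\<close>

lemma half_diff_inverse_square_less_ln:
  assumes "c > (1::real)"
  shows "(1 - 1 / c\<^sup>2) / 2 < ln c"
proof -
  have "ln (1 / c\<^sup>2) < 1 / c\<^sup>2 - 1"
  proof -
    have "0 < 1 / c\<^sup>2" "1 / c\<^sup>2 \<noteq> 1"
      using assms by (auto simp: power2_eq_1_iff)
    thus ?thesis
      using ln_le_minus_one[of "1 / c\<^sup>2"] ln_eq_minus_one[of "1 / c\<^sup>2"] by (meson order_le_less)
  qed
  moreover have "ln (1 / c\<^sup>2) = - 2 * ln c"
    using assms by (simp add: ln_div ln_realpow)
  ultimately show ?thesis by simp
qed

text \<open>Multiplying the integrand by \<open>c\<close>, \<open>1 / c\<close> or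
  \<open>1 / c^2\<close> with \<open>c = cosh t\<close> shifts the order by -1, +1 or +2. The minus
  sign in the derivative turns the upper bound on \<open>ln c\<close> into the lower bound and
  conversely.\<close>

lemma Ki_derivative_bounds:
  assumes "x > 0"
  shows "1 / 2 * (Ki (\<alpha> + 1) x - Ki (\<alpha> - 1) x)
      < - (LINT t:{0..}|lborel. bickley_integrand \<alpha> x t * ln (cosh t))" (is ?lower)
    and "- (LINT t:{0..}|lborel. bickley_integrand \<alpha> x t * ln (cosh t))
      < 1 / 2 * (Ki (\<alpha> + 2) x - Ki \<alpha> x)" (is ?upper)
proof -
  let ?b = "\<lambda>a t. bickley_integrand a x t"
  note int = bickley_integrable_pos[OF assms] Ki_integrand_ln_integrable[OF assms]
  have shift: "?b (\<alpha> - 1) t = ?b \<alpha> t * cosh t" "?b (\<alpha> + 1) t = ?b \<alpha> t * (1 / cosh t)"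
    "?b (\<alpha> + 2) t = ?b \<alpha> t * (1 / (cosh t)\<^sup>2)" for t
    by (simp_all add: bickley_integrand_def powr_add powr_diff powr_minus field_simps)
  have pos: "?b \<alpha> t > 0" for t
    by (simp add: bickley_integrand_def)
  have c: "cosh t > 1" if "t > 0" for t :: real
    using that cosh_real_strict_mono[of 0 t] by simp

  have "(LINT t:{0..}|lborel. ?b \<alpha> t * ln (cosh t)) < (LINT t:{0..}|lborel. (?b (\<alpha> - 1) t - ?b (\<alpha> + 1) t) / 2)"
  proof (rule half_line_integral_strict_mono)
    show less: "?b \<alpha> t * ln (cosh t) < (?b (\<alpha> - 1) t - ?b (\<alpha> + 1) t) / 2" if "t > 0" for t
      using mult_strict_left_mono[OF ln_less_half_diff_inverse[OF c[OF that]] pos[of t]]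
      unfolding shift by (simp add: algebra_simps)
    show "?b \<alpha> t * ln (cosh t) \<le> (?b (\<alpha> - 1) t - ?b (\<alpha> + 1) t) / 2" if "t \<ge> 0" for t
      using less[of t] that by (cases "t = 0") (auto simp: shift)
  qed (intro set_integrable_divide set_integral_diff int)+
  thus ?lower
    by (simp add: Ki_def set_integral_diff int)

  have "(LINT t:{0..}|lborel. (?b \<alpha> t - ?b (\<alpha> + 2) t) / 2) < (LINT t:{0..}|lborel. ?b \<alpha> t * ln (cosh t))"
  proof (rule half_line_integral_strict_mono)
    show less: "(?b \<alpha> t - ?b (\<alpha> + 2) t) / 2 < ?b \<alpha> t * ln (cosh t)" if "t > 0" for t
      using mult_strict_left_mono[OF half_diff_inverse_square_less_ln[OF c[OF that]] pos[of t]]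
      unfolding shift by (simp add: algebra_simps)
    show "(?b \<alpha> t - ?b (\<alpha> + 2) t) / 2 \<le> ?b \<alpha> t * ln (cosh t)" if "t \<ge> 0" for t
      using less[of t] that by (cases "t = 0") (auto simp: shift)
  qed (intro set_integrable_divide set_integral_diff int)+
  thus ?upper
    by (simp add: Ki_def set_integral_diff int)
qed

section \<open>Carlson's inequality and bound (c)\<close>

text \<open>An antiderivative is \<open>arctan (sqrt (P / Q) * t) / sqrt (P * Q)\<close>, evaluated
  between 0 and infinity.\<close>

lemma nn_integral_inverse_quadratic:
  assumes "P > 0" "Q > 0"
  shows "(\<integral>\<^sup>+ t. ennreal (1 / (Q + P * t\<^sup>2)) * indicator {0..} t \<partial>lborel) = ennreal (pi / (2 * sqrt (P * Q)))"
proof -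
  have w: "Q + P * t\<^sup>2 > 0" for t
    using assms by (intro add_pos_nonneg) auto
  have "(\<integral>\<^sup>+ t. ennreal (1 / (Q + P * t\<^sup>2)) * indicator {0..} t \<partial>lborel)
      = ennreal (pi / 2 / sqrt (P * Q) - arctan (sqrt (P / Q) * 0) / sqrt (P * Q))"
  proof (rule nn_integral_FTC_atLeast)
    fix t :: real
    have "sqrt (P / Q) / sqrt (P * Q) = 1 / Q"
      using assms by (simp add: real_sqrt_mult real_sqrt_divide field_simps)
    moreover have "(sqrt (P / Q) * t)\<^sup>2 = P / Q * t\<^sup>2"
      using assms by (simp add: power_mult_distrib)
    ultimately have "1 / (1 + (sqrt (P / Q) * t)\<^sup>2) * sqrt (P / Q) / sqrt (P * Q) = 1 / (1 + P / Q * t\<^sup>2) * (1 / Q)"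
      by (simp only: times_divide_eq_right[symmetric] mult.assoc)
    also have "\<dots> = 1 / (Q + P * t\<^sup>2)"
      using assms w[of t] by (simp add: field_simps)
    finally have eq: "1 / (1 + (sqrt (P / Q) * t)\<^sup>2) * sqrt (P / Q) / sqrt (P * Q) = 1 / (Q + P * t\<^sup>2)" .
    have "((\<lambda>t. arctan (sqrt (P / Q) * t) / sqrt (P * Q)) has_real_derivative
        1 / (1 + (sqrt (P / Q) * t)\<^sup>2) * sqrt (P / Q) / sqrt (P * Q)) (at t)"
      by (rule DERIV_cdivide) (auto intro!: derivative_eq_intros simp: inverse_eq_divide)
    thus "((\<lambda>t. arctan (sqrt (P / Q) * t) / sqrt (P * Q)) has_real_derivative 1 / (Q + P * t\<^sup>2)) (at t)"
      by (simp only: eq)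
    show "0 \<le> 1 / (Q + P * t\<^sup>2)"
      using w[of t] by simp
  next
    have "filterlim (\<lambda>t. sqrt (P / Q) * t) at_top at_top"
      using assms by (intro filterlim_tendsto_pos_mult_at_top[OF tendsto_const] filterlim_ident) auto
    hence "((\<lambda>t. arctan (sqrt (P / Q) * t)) \<longlongrightarrow> pi / 2) at_top"
      by (rule filterlim_compose[OF tendsto_arctan_at_top])
    thus "((\<lambda>t. arctan (sqrt (P / Q) * t) / sqrt (P * Q)) \<longlongrightarrow> pi / 2 / sqrt (P * Q)) at_top"
      using assms by (intro tendsto_divide tendsto_const) auto
  qed simp
  thus ?thesis by simp
qed

text \<open>Carlson's inequality is the Cauchy--Schwarz inequality with the weight \<open>Q + P t\<^sup>2\<close>,
  whose coefficients balance the two resulting terms.\<close>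

lemma Ki_power4_le:
  assumes "x > 0"
  shows "(Ki \<alpha> x) ^ 4 \<le> pi\<^sup>2 / 2 * Ki (2 * \<alpha>) (2 * x) * Ki (2 * \<alpha> - 2) (2 * x)"
proof -
  \<comment> \<open>\<open>P\<close> is the integral of the squared integrand. \<open>Q\<close>
    bounds the integral of \<open>t^2\<close> times that square, because
    \<open>t^2 <= (cosh t)^2 / 2\<close>. Each of the two terms of the weighted integral is then at
    most \<open>P * Q\<close>.\<close>
  define P where "P = Ki (2 * \<alpha>) (2 * x)"
  define Q where "Q = Ki (2 * \<alpha> - 2) (2 * x) / 2"
  define w where "w = (\<lambda>t. Q + P * t\<^sup>2)"
  have int: "set_integrable lborel {0..} (bickley_integrand a (2 * x))" for a
    using assms by (intro bickley_integrable_pos) auto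
  have PQ: "P > 0" "Q > 0"
    unfolding P_def Q_def using Ki_pos[OF int] by auto
  have w: "w t > 0" for t
    unfolding w_def using PQ by (intro add_pos_nonneg) auto
  have [measurable]: "w \<in> borel_measurable borel"
    unfolding w_def by measurable
  \<comment> \<open>The integrand is factored through \<open>sqrt (w t)\<close>, so that the squared
    second factor is the arctangent integrand.\<close>
  let ?F = "\<lambda>t. ennreal (indicator {0..} t * (bickley_integrand \<alpha> x t * sqrt (w t)))"
  let ?G = "\<lambda>t. ennreal (indicator {0..} t * (1 / sqrt (w t)))"
  have "ennreal (Ki \<alpha> x) = (\<integral>\<^sup>+ t. ?F t * ?G t \<partial>lborel)"
    unfolding Ki_conv_nn_integral[OF bickley_integrable_pos[OF assms]]
    using less_imp_neq[OF w]
    by (intro nn_integral_cong)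
       (auto simp: indicator_def bickley_integrand_nonneg less_imp_le[OF w] simp flip: ennreal_mult)
  hence "(ennreal (Ki \<alpha> x))\<^sup>2 = (\<integral>\<^sup>+ t. ?F t * ?G t \<partial>lborel)\<^sup>2"
    by simp
  also have "\<dots> \<le> (\<integral>\<^sup>+ t. (?F t)\<^sup>2 \<partial>lborel) * (\<integral>\<^sup>+ t. (?G t)\<^sup>2 \<partial>lborel)"
    by (rule Cauchy_Schwarz_nn_integral) measurable
  also have "\<dots> \<le> ennreal (2 * (P * Q)) * ennreal (pi / (2 * sqrt (P * Q)))"
  proof (rule mult_mono)
    let ?B = "\<lambda>t. Q * bickley_integrand (2 * \<alpha>) (2 * x) t + P / 2 * bickley_integrand (2 * \<alpha> - 2) (2 * x) t"
    have B: "set_integrable lborel {0..} ?B"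
      by (intro set_integral_add set_integrable_mult_right int)
    have "(\<integral>\<^sup>+ t. (?F t)\<^sup>2 \<partial>lborel) \<le> (\<integral>\<^sup>+ t. ennreal (indicator {0..} t *\<^sub>R ?B t) \<partial>lborel)"
    proof (rule nn_integral_mono)
      fix t :: real
      let ?b = "bickley_integrand (2 * \<alpha>) (2 * x) t"
      have "exp (- x * cosh t) ^ 2 = exp (- (2 * x) * cosh t)" "(cosh t powr (- \<alpha>)) ^ 2 = cosh t powr (- (2 * \<alpha>))"
        by (simp_all add: power2_eq_square mult_exp_exp flip: powr_add)
      hence sq: "(bickley_integrand \<alpha> x t)\<^sup>2 = ?b"
        by (simp only: bickley_integrand_def power_mult_distrib)
      have "(cosh t)\<^sup>2 * ?b = bickley_integrand (2 * \<alpha> - 2) (2 * x) t"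
        by (simp add: bickley_integrand_def powr_diff powr_minus field_simps)
      moreover have "t\<^sup>2 * ?b \<le> (cosh t)\<^sup>2 / 2 * ?b"
        using cosh_square_ge[of t] by (intro mult_right_mono bickley_integrand_nonneg) simp
      ultimately have "P * (t\<^sup>2 * ?b) \<le> P * (bickley_integrand (2 * \<alpha> - 2) (2 * x) t / 2)"
        using PQ by (intro mult_left_mono) auto
      hence "(bickley_integrand \<alpha> x t)\<^sup>2 * w t \<le> ?B t"
        unfolding sq w_def by (simp add: algebra_simps)
      hence "(bickley_integrand \<alpha> x t * sqrt (w t))\<^sup>2 \<le> ?B t"
        using less_imp_le[OF w[of t]] by (simp add: power_mult_distrib)
      thus "(?F t)\<^sup>2 \<le> ennreal (indicator {0..} t *\<^sub>R ?B t)"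
        by (auto simp: indicator_def ennreal_power bickley_integrand_nonneg less_imp_le[OF w] intro!: ennreal_leI)
    qed
    also have "\<dots> = ennreal (LINT t:{0..}|lborel. ?B t)"
      unfolding set_lebesgue_integral_def
      using B PQ by (intro nn_integral_eq_integral) (auto simp: set_integrable_def bickley_integrand_nonneg)
    also have "(LINT t:{0..}|lborel. ?B t) = 2 * (P * Q)"
      by (simp add: set_integral_add int Ki_def P_def Q_def)
    finally show "(\<integral>\<^sup>+ t. (?F t)\<^sup>2 \<partial>lborel) \<le> ennreal (2 * (P * Q))" .
    have "(\<integral>\<^sup>+ t. (?G t)\<^sup>2 \<partial>lborel) = (\<integral>\<^sup>+ t. ennreal (1 / (Q + P * t\<^sup>2)) * indicator {0..} t \<partial>lborel)"
      using less_imp_le[OF w]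
      by (intro nn_integral_cong) (auto simp: indicator_def ennreal_power power_divide w_def)
    thus "(\<integral>\<^sup>+ t. (?G t)\<^sup>2 \<partial>lborel) \<le> ennreal (pi / (2 * sqrt (P * Q)))"
      by (simp add: nn_integral_inverse_quadratic PQ)
  qed auto
  also have "\<dots> = ennreal (pi * sqrt (P * Q))"
    using PQ by (simp add: real_sqrt_mult field_simps flip: ennreal_mult)
  finally have "(Ki \<alpha> x)\<^sup>2 \<le> pi * sqrt (P * Q)"
    using PQ less_imp_le[OF Ki_pos[OF bickley_integrable_pos[OF assms]]]
    by (simp add: ennreal_power)
  \<comment> \<open>A second squaring removes the root; the factor 1/2 in the claim is the one
    inside \<open>Q\<close>.\<close>
  hence "((Ki \<alpha> x)\<^sup>2)\<^sup>2 \<le> (pi * sqrt (P * Q))\<^sup>2"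
    by (intro power_mono) auto
  also have "\<dots> = pi\<^sup>2 * (P * Q)"
    using PQ by (simp add: power_mult_distrib)
  finally show ?thesis
    by (simp add: P_def Q_def)
qed

section \<open>Power bound on the exponential, and bound (d)\<close>

text \<open>Scaling \<open>ln u <= u - 1\<close> at \<open>u = y / a\<close> by \<open>a\<close>
  expresses that \<open>y powr a * exp (- y)\<close> is largest at \<open>y = a\<close>.\<close>

lemma exp_minus_le_powr:
  assumes "a > (0::real)" "y > 0"
  shows "exp (- y) \<le> (a / (exp 1 * y)) powr a"
proof -
  have "ln (y / a) \<le> y / a - 1"
    using assms by (intro ln_le_minus_one) auto
  hence "a * ln (y / a) \<le> a * (y / a - 1)"
    using assms by (intro mult_left_mono) auto
  hence "- y \<le> a * (ln a - (1 + ln y))"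
    using assms by (simp add: ln_div algebra_simps)
  also have "\<dots> = a * ln (a / (exp 1 * y))"
    using assms by (simp add: ln_div ln_mult)
  finally show ?thesis
    using assms by (simp add: powr_def)
qed

text \<open>Trading the exponential for a multiple of \<open>cosh t powr (- \<alpha>)\<close>
  doubles the order and leaves the explicitly known value at zero.\<close>

lemma Ki_le_powr:
  assumes "\<alpha> > 0" "x > 0"
  shows "Ki \<alpha> x \<le> sqrt pi * \<alpha> powr \<alpha> * Gamma \<alpha> / (2 * (exp 1 * x) powr \<alpha> * Gamma (\<alpha> + 1 / 2))"
proof -
  let ?C = "\<alpha> powr \<alpha> / (exp 1 * x) powr \<alpha>"
  have "Ki \<alpha> x \<le> (LINT t:{0..}|lborel. ?C * bickley_integrand (2 * \<alpha>) 0 t)"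
    unfolding Ki_def
  proof (rule set_integral_mono)
    show "set_integrable lborel {0..} (bickley_integrand \<alpha> x)"
      using assms(2) by (rule bickley_integrable_pos)
    show "set_integrable lborel {0..} (\<lambda>t. ?C * bickley_integrand (2 * \<alpha>) 0 t)"
      using assms by (intro set_integrable_mult_right bickley_integrable_zero) auto
    fix t :: real
    have "exp (- (x * cosh t)) \<le> (\<alpha> / (exp 1 * (x * cosh t))) powr \<alpha>"
      using assms by (intro exp_minus_le_powr) auto
    also have "\<dots> = ?C * cosh t powr (- \<alpha>)"
      using assms by (simp add: powr_divide powr_mult powr_minus field_simps)
    finally have "bickley_integrand \<alpha> x t \<le> ?C * cosh t powr (- \<alpha>) * cosh t powr (- \<alpha>)"
      unfolding bickley_integrand_def by (intro mult_right_mono) auto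
    also have "\<dots> = ?C * bickley_integrand (2 * \<alpha>) 0 t"
      by (simp add: bickley_integrand_def flip: powr_add)
    finally show "bickley_integrand \<alpha> x t \<le> ?C * bickley_integrand (2 * \<alpha>) 0 t" .
  qed
  also have "\<dots> = ?C * Ki (2 * \<alpha>) 0"
    by (simp add: Ki_def)
  also have "Ki (2 * \<alpha>) 0 = sqrt pi * Gamma \<alpha> / (2 * Gamma (\<alpha> + 1 / 2))"
    using assms Ki_zero[of "2 * \<alpha>"] by (simp add: add_divide_distrib)
  finally show ?thesis
    by (simp add: mult_ac)
qed

section \<open>Hoelder's inequality and the chain of bounds (e)\<close>

text \<open>Normalise both functions by their norms and integrate Young's inequality. If a norm is
  zero, the product vanishes almost everywhere.\<close>

lemma Hoelder_inequality:
  fixes f g :: "'a \<Rightarrow> real"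
  assumes pq: "p > 1" "q > 1" "1 / p + 1 / q = 1"
    and [measurable]: "f \<in> borel_measurable M" "g \<in> borel_measurable M"
    and nonneg: "\<And>t. f t \<ge> 0" "\<And>t. g t \<ge> 0"
    and f: "integrable M (\<lambda>t. f t powr p)" and g: "integrable M (\<lambda>t. g t powr q)"
  shows "(\<integral>t. f t * g t \<partial>M) \<le> (\<integral>t. f t powr p \<partial>M) powr (1 / p) * (\<integral>t. g t powr q \<partial>M) powr (1 / q)"
proof -
  define A where "A = (\<integral>t. f t powr p \<partial>M)"
  define B where "B = (\<integral>t. g t powr q \<partial>M)"
  have "A \<ge> 0" "B \<ge> 0"
    unfolding A_def B_def by (simp_all add: integral_nonneg_AE)
  show ?thesis
  proof (cases "A = 0 \<or> B = 0")
    case True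
    hence "AE t in M. f t * g t = 0"
    proof
      assume "A = 0"
      hence "AE t in M. f t powr p = 0"
        using f unfolding A_def by (subst (asm) integral_nonneg_eq_0_iff_AE) auto
      thus ?thesis by (rule eventually_mono) auto
    next
      assume "B = 0"
      hence "AE t in M. g t powr q = 0"
        using g unfolding B_def by (subst (asm) integral_nonneg_eq_0_iff_AE) auto
      thus ?thesis by (rule eventually_mono) auto
    qed
    hence "(\<integral>t. f t * g t \<partial>M) = 0"
      by (rule integral_eq_zero_AE)
    thus ?thesis by simp
  next
    case False
    with \<open>A \<ge> 0\<close> \<open>B \<ge> 0\<close> have AB: "A > 0" "B > 0" by auto
    define a b where "a = A powr (1 / p)" and "b = B powr (1 / q)"
    have ab: "a > 0" "b > 0" using AB by (auto simp: a_def b_def)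
    have powers: "a powr p = A" "b powr q = B"
      using pq AB by (auto simp: a_def b_def powr_powr)
    have young: "f t * g t \<le> a * b * (f t powr p / (A * p) + g t powr q / (B * q))" for t
    proof -
      have "f t / a * (g t / b) \<le> (f t / a) powr p / p + (g t / b) powr q / q"
        using pq ab nonneg by (intro Youngs_inequality) auto
      also have "\<dots> = f t powr p / (A * p) + g t powr q / (B * q)"
        using ab nonneg by (simp add: powr_divide powers)
      finally show ?thesis
        using ab by (simp add: field_simps)
    qed
    have "(\<integral>t. f t * g t \<partial>M) \<le> (\<integral>t. a * b * (f t powr p / (A * p) + g t powr q / (B * q)) \<partial>M)"
    proof (rule integral_mono')
      show "integrable M (\<lambda>t. a * b * (f t powr p / (A * p) + g t powr q / (B * q)))"
        using f g by auto
      show "0 \<le> a * b * (f t powr p / (A * p) + g t powr q / (B * q))" for t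
        \<comment> \<open>The majorant is nonnegative because it lies above the nonnegative
          product.\<close>
        using order_trans[OF mult_nonneg_nonneg[OF nonneg] young] .
    qed (rule young)
    also have "\<dots> = a * b * (A / (A * p) + B / (B * q))"
      using f g by (simp add: A_def B_def)
    also have "A / (A * p) + B / (B * q) = 1"
      using AB pq by simp
    finally show ?thesis
      by (simp add: a_def b_def A_def B_def)
  qed
qed

text \<open>For \<open>\<alpha> > 1\<close> both integrals at zero are finite, and
  \<open>exp (- y) >= 1 - y\<close> with \<open>y = x * cosh t\<close> is integrated.\<close>

lemma Ki_ext_lower_bound:
  assumes "\<alpha> > 0" "x > 0"
  shows "max (Ki_ext \<alpha> 0 - ereal x * Ki_ext (\<alpha> - 1) 0) 0 \<le> ereal (Ki \<alpha> x)"
proof -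
  have Ki_nonneg: "0 \<le> ereal (Ki \<alpha> x)"
    using Ki_pos[OF bickley_integrable_pos[OF assms(2)]] by (simp add: less_imp_le)
  have \<alpha>: "Ki_ext \<alpha> 0 = ereal (Ki \<alpha> 0)"
    using assms by (intro Ki_ext_eq_Ki bickley_integrable_zero)
  show ?thesis
  proof (cases "\<alpha> > 1")
    case True
    note int = bickley_integrable_zero[OF assms(1)] bickley_integrable_zero[of "\<alpha> - 1"]
    have "Ki \<alpha> 0 - x * Ki (\<alpha> - 1) 0
        = (LINT t:{0..}|lborel. bickley_integrand \<alpha> 0 t - x * bickley_integrand (\<alpha> - 1) 0 t)"
      using True by (simp add: Ki_def set_integral_diff int)
    also have "\<dots> \<le> Ki \<alpha> x"
      unfolding Ki_def
    proof (rule set_integral_mono)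
      show "set_integrable lborel {0..} (\<lambda>t. bickley_integrand \<alpha> 0 t - x * bickley_integrand (\<alpha> - 1) 0 t)"
        using True by (intro set_integral_diff set_integrable_mult_right int) auto
      show "set_integrable lborel {0..} (bickley_integrand \<alpha> x)"
        using assms(2) by (rule bickley_integrable_pos)
      fix t :: real
      have "(1 - x * cosh t) * cosh t powr (- \<alpha>) \<le> exp (- x * cosh t) * cosh t powr (- \<alpha>)"
        using exp_ge_add_one_self[of "- x * cosh t"] by (intro mult_right_mono) auto
      moreover have "cosh t * cosh t powr (- \<alpha>) = cosh t powr (- (\<alpha> - 1))"
        by (simp add: powr_mult_base)
      ultimately show "bickley_integrand \<alpha> 0 t - x * bickley_integrand (\<alpha> - 1) 0 t \<le> bickley_integrand \<alpha> x t"
        by (simp add: bickley_integrand_def algebra_simps)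
    qed
    finally show ?thesis
      using True Ki_nonneg \<alpha> by (simp add: Ki_ext_eq_Ki bickley_integrable_zero)
  next
    case False
    \<comment> \<open>Here \<open>\<alpha> - 1 <= 0\<close>, so the subtracted term is infinite
      while \<open>Ki_ext \<alpha> 0\<close> is finite; the positive part is 0.\<close>
    hence "Ki_ext \<alpha> 0 - ereal x * Ki_ext (\<alpha> - 1) 0 = - \<infinity>"
      using assms by (simp add: \<alpha> Ki_ext_zero_nonpos)
    thus ?thesis using Ki_nonneg by simp
  qed
qed

text \<open>The exponential and the power of \<open>cosh\<close> are the two Hoelder factors: the
  exponent \<open>p\<close> rescales \<open>x\<close> to \<open>x * p\<close>, and \<open>q\<close>
  rescales the order to \<open>\<alpha> * q\<close>.\<close>

lemma Ki_le_Hoelder: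
  assumes pq: "p > 1" "q > 1" "1 / p + 1 / q = 1" and "\<alpha> > 0" "x > 0"
  shows "Ki \<alpha> x \<le> bessel_K0 (x * p) powr (1 / p) * Ki (\<alpha> * q) 0 powr (1 / q)"
proof -
  \<comment> \<open>Both factors carry the indicator, which survives the powers because
    \<open>0 powr _ = 0\<close>.\<close>
  let ?f = "\<lambda>t. indicator {0..} t * exp (- x * cosh t)"
  let ?g = "\<lambda>t. indicator {0..} t * cosh t powr (- \<alpha>)"
  have f: "?f t powr p = indicator {0..} t *\<^sub>R bickley_integrand 0 (x * p) t" for t
    using pq by (auto simp: indicator_def bickley_integrand_def exp_powr_real)
  have g: "?g t powr q = indicator {0..} t *\<^sub>R bickley_integrand (\<alpha> * q) 0 t" for t
    using pq by (auto simp: indicator_def bickley_integrand_def powr_powr)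
  have "(\<integral>t. ?f t * ?g t \<partial>lborel) \<le> (\<integral>t. ?f t powr p \<partial>lborel) powr (1 / p) * (\<integral>t. ?g t powr q \<partial>lborel) powr (1 / q)"
  proof (rule Hoelder_inequality[OF pq])
    show "integrable lborel (\<lambda>t. ?f t powr p)"
      unfolding f using bickley_integrable_pos[of "x * p" 0] assms by (simp add: set_integrable_def)
    show "integrable lborel (\<lambda>t. ?g t powr q)"
      unfolding g using bickley_integrable_zero[of "\<alpha> * q"] assms by (simp add: set_integrable_def)
  qed auto
  also have "(\<integral>t. ?f t * ?g t \<partial>lborel) = Ki \<alpha> x"
    unfolding Ki_def set_lebesgue_integral_def bickley_integrand_def
    by (intro Bochner_Integration.integral_cong) (auto simp: indicator_def)
  finally show ?thesis
    unfolding f g by (simp add: bessel_K0_eq_Ki Ki_def set_lebesgue_integral_def)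
qed

text \<open>Insert the Gaussian bound on K_0 and the closed form at zero. The root of order
  \<open>p\<close> turns \<open>exp (- (x * p))\<close> into \<open>exp (- x)\<close>, and
  \<open>1 / p + 1 / q = 1\<close> recombines the powers of \<open>sqrt pi\<close>.\<close>

lemma bessel_K0_Ki_zero_bound:
  assumes pq: "p > 1" "q > 1" "1 / p + 1 / q = 1" and "\<alpha> > 0" "x > 0"
  shows "bessel_K0 (x * p) powr (1 / p) * Ki (\<alpha> * q) 0 powr (1 / q)
    \<le> sqrt pi / (2 powr (1 / q + 1 / (2 * p)) * p powr (1 / (2 * p)))
        * (Gamma (\<alpha> * q / 2) / Gamma ((\<alpha> * q + 1) / 2)) powr (1 / q)
        * (exp (- x) / x powr (1 / (2 * p)))"
proof -
  let ?R = "Gamma (\<alpha> * q / 2) / Gamma ((\<alpha> * q + 1) / 2)"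
  have aq: "\<alpha> * q > 0" using assms by simp
  hence R: "?R > 0" by (intro divide_pos_pos Gamma_real_pos) auto
  have "bessel_K0 (x * p) \<ge> 0"
    unfolding bessel_K0_eq_Ki using assms by (intro less_imp_le Ki_pos bickley_integrable_pos) auto
  hence "bessel_K0 (x * p) powr (1 / p) \<le> (exp (- (x * p)) * sqrt (pi / (2 * (x * p)))) powr (1 / p)"
    using assms by (intro powr_mono2 bessel_K0_le) auto
  also have "\<dots> = exp (- x) * (pi / (2 * (x * p))) powr (1 / (2 * p))"
    using assms by (simp add: powr_mult exp_powr_real powr_powr flip: powr_half_sqrt)
  also have "\<dots> = exp (- x) * (sqrt pi powr (1 / p) / (2 powr (1 / (2 * p)) * x powr (1 / (2 * p)) * p powr (1 / (2 * p))))"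
    using assms by (simp add: powr_divide powr_mult powr_powr flip: powr_half_sqrt)
  finally have K0: "bessel_K0 (x * p) powr (1 / p) \<le> \<dots>" .
  have "Ki (\<alpha> * q) 0 = sqrt pi / 2 * ?R"
    using Ki_zero[OF aq] by simp
  hence Kiq: "Ki (\<alpha> * q) 0 powr (1 / q) = sqrt pi powr (1 / q) / 2 powr (1 / q) * ?R powr (1 / q)"
    using R by (simp only: powr_mult powr_divide)
  have sqrt_pi: "sqrt pi powr (1 / p) * sqrt pi powr (1 / q) = sqrt pi"
    using pq by (simp flip: powr_add)
  have "bessel_K0 (x * p) powr (1 / p) * Ki (\<alpha> * q) 0 powr (1 / q)
      \<le> exp (- x) * (sqrt pi powr (1 / p) / (2 powr (1 / (2 * p)) * x powr (1 / (2 * p)) * p powr (1 / (2 * p))))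
        * (sqrt pi powr (1 / q) / 2 powr (1 / q) * ?R powr (1 / q))"
    unfolding Kiq by (intro mult_right_mono K0) auto
  also have "\<dots> = (sqrt pi powr (1 / p) * sqrt pi powr (1 / q)) / (2 powr (1 / q) * 2 powr (1 / (2 * p)) * p powr (1 / (2 * p)))
      * ?R powr (1 / q) * (exp (- x) / x powr (1 / (2 * p)))"
    by (simp only: times_divide_eq_left times_divide_eq_right divide_divide_eq_left mult_ac)
  also have "\<dots> = sqrt pi / (2 powr (1 / q + 1 / (2 * p)) * p powr (1 / (2 * p)))
      * ?R powr (1 / q) * (exp (- x) / x powr (1 / (2 * p)))"
    by (simp only: sqrt_pi powr_add)
  finally show ?thesis .
qed

text \<open>In (b) the existence of \<open>D\<close> makes differentiability in the order part of
  the claim. In (e) the lower bound uses \<open>Ki_ext\<close> so that a divergent integral at zero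
  counts as infinite, whereas the real-valued \<open>Ki (\<alpha> * q) 0\<close> is faithful because
  \<open>\<alpha> * q > 0\<close>.\<close>

theorem theorem2:
  shows
    "(\<forall>\<alpha> x :: real. \<alpha> > 1 / 4 \<longrightarrow> x > 0 \<longrightarrow>
        Ki \<alpha> x \<le> sqrt pi * exp (- x) * Gamma (\<alpha> - 1 / 4) / (2 * Gamma \<alpha> * x powr (1 / 4)))
   \<and> (\<forall>\<alpha> x :: real. x > 0 \<longrightarrow>
        (\<exists>D. ((\<lambda>a. Ki a x) has_real_derivative D) (at \<alpha>)
           \<and> 1 / 2 * (Ki (\<alpha> + 1) x - Ki (\<alpha> - 1) x) < D
           \<and> D < 1 / 2 * (Ki (\<alpha> + 2) x - Ki \<alpha> x)))
   \<and> (\<forall>\<alpha> x :: real. x > 0 \<longrightarrow>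
        (Ki \<alpha> x) ^ 4 \<le> pi\<^sup>2 / 2 * Ki (2 * \<alpha>) (2 * x) * Ki (2 * \<alpha> - 2) (2 * x))
   \<and> (\<forall>\<alpha> x :: real. \<alpha> > 0 \<longrightarrow> x > 0 \<longrightarrow>
        Ki \<alpha> x \<le> sqrt pi * \<alpha> powr \<alpha> * Gamma \<alpha>
                    / (2 * (exp 1 * x) powr \<alpha> * Gamma (\<alpha> + 1 / 2)))
   \<and> (\<forall>p q :: real. 1 / p + 1 / q = 1 \<longrightarrow> min p q > 1 \<longrightarrow>
        (\<forall>\<alpha> x :: real. \<alpha> > 0 \<longrightarrow> x > 0 \<longrightarrow>
           max (Ki_ext \<alpha> 0 - ereal x * Ki_ext (\<alpha> - 1) 0) 0 \<le> ereal (Ki \<alpha> x)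
         \<and> Ki \<alpha> x \<le> bessel_K0 (x * p) powr (1 / p) * Ki (\<alpha> * q) 0 powr (1 / q)
         \<and> bessel_K0 (x * p) powr (1 / p) * Ki (\<alpha> * q) 0 powr (1 / q)
             \<le> sqrt pi / (2 powr (1 / q + 1 / (2 * p)) * p powr (1 / (2 * p)))
                 * (Gamma (\<alpha> * q / 2) / Gamma ((\<alpha> * q + 1) / 2)) powr (1 / q)
                 * (exp (- x) / x powr (1 / (2 * p)))))"
proof (intro conjI allI impI)
  fix \<alpha> x :: real assume "\<alpha> > 1 / 4" "x > 0"
  thus "Ki \<alpha> x \<le> sqrt pi * exp (- x) * Gamma (\<alpha> - 1 / 4) / (2 * Gamma \<alpha> * x powr (1 / 4))"
    by (rule Ki_le_Gamma_quotient)
next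
  fix \<alpha> x :: real assume "x > 0"
  thus "\<exists>D. ((\<lambda>a. Ki a x) has_real_derivative D) (at \<alpha>)
      \<and> 1 / 2 * (Ki (\<alpha> + 1) x - Ki (\<alpha> - 1) x) < D
      \<and> D < 1 / 2 * (Ki (\<alpha> + 2) x - Ki \<alpha> x)"
    using Ki_has_real_derivative Ki_derivative_bounds by blast
next
  fix \<alpha> x :: real assume "x > 0"
  thus "(Ki \<alpha> x) ^ 4 \<le> pi\<^sup>2 / 2 * Ki (2 * \<alpha>) (2 * x) * Ki (2 * \<alpha> - 2) (2 * x)"
    by (rule Ki_power4_le)
next
  fix \<alpha> x :: real assume "\<alpha> > 0" "x > 0"
  thus "Ki \<alpha> x \<le> sqrt pi * \<alpha> powr \<alpha> * Gamma \<alpha> / (2 * (exp 1 * x) powr \<alpha> * Gamma (\<alpha> + 1 / 2))"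
    by (rule Ki_le_powr)
next
  fix \<alpha> x :: real assume "\<alpha> > 0" "x > 0"
  thus "max (Ki_ext \<alpha> 0 - ereal x * Ki_ext (\<alpha> - 1) 0) 0 \<le> ereal (Ki \<alpha> x)"
    by (rule Ki_ext_lower_bound)
next
  fix p q \<alpha> x :: real
  assume "1 / p + 1 / q = 1" "min p q > 1" "\<alpha> > 0" "x > 0"
  thus "Ki \<alpha> x \<le> bessel_K0 (x * p) powr (1 / p) * Ki (\<alpha> * q) 0 powr (1 / q)"
    by (intro Ki_le_Hoelder) auto
next
  fix p q \<alpha> x :: real
  assume "1 / p + 1 / q = 1" "min p q > 1" "\<alpha> > 0" "x > 0"
  thus "bessel_K0 (x * p) powr (1 / p) * Ki (\<alpha> * q) 0 powr (1 / q)
      \<le> sqrt pi / (2 powr (1 / q + 1 / (2 * p)) * p powr (1 / (2 * p)))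
          * (Gamma (\<alpha> * q / 2) / Gamma ((\<alpha> * q + 1) / 2)) powr (1 / q)
          * (exp (- x) / x powr (1 / (2 * p)))"
    by (intro bessel_K0_Ki_zero_bound) auto
qed

end
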